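(* Let $\tau>0$ be a fixed real number. Let $N\ge1$ and let $\{u_k\}_{k=1}^N$, $\{v_k\}_{k=1}^N$ be nonnegative numbers such that $$\sum_{k=1}^N(u_k+v_k)=1,\qquad\sum_{k=1}^Nv_k>0,$$ the greatest common divisor of those indices $k$ for which $u_k+v_k>0$ equals $1$, $u_k=0$ for every odd $k\in\{1,\dots,N\}$, and $v_k=0$ for every even $k\in\{1,\dots,N\}$. Put $J=\sum_{k=1}^Nk(u_k+v_k)$. Then there exists a function $C:\mathbb R^+\to\mathbb R$ with $\lim_{t\to+\infty}C(t)=0$ such that for all positive numbers $\Pi_1,\Pi_2$ and all continuous functions $X_1,X_2:\mathbb R\to\mathbb C$ satisfying, for $j=1,2$, $$|X_j(t)|\le\Pi_j\,e^{-\tau t}\ \text{ for all }t\in\mathbb R^+,\qquad X_j(t)=0\ \text{ for all }t\in\mathbb R^-,$$ the following holds. There exists a unique pair of continuous functions $Z_1,Z_2:\mathbb R\to\mathbb C$ satisfying, for $j=1,2$, $$Z_j(t)=X_j(t)+\sum_{k=1}^N\bigl(u_kZ_j(t-k)+v_kZ_{3-j}(t-k)\bigr)\ \text{ for all }t\in\mathbb R^+,\qquad Z_j(t)=0\ \text{ for all }t\in\mathbb R^-,$$ and for this pair $$|Z_j(t)-s(t-j+1)|\le(\Pi_1+\Pi_2)\cdot C(t)\qquad\text{for all }t\in\mathbb R^+,\ j=1,2,$$ where $s$ is the continuous $2$-periodic function $$s(t)=\frac1J\sum_{k=-\infty}^{+\infty}\bigl(X_1(t-2k)+X_2(t-2k-1)\bigr),\qquad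 t\in\mathbb R.$$
   Context: $\mathbb R^+$ and $\mathbb R^-$ denote the positive and negative half-lines. The function $C$ may depend on $\tau$, $N$, $\{u_k\}$, $\{v_k\}$, but not on $X_1,X_2$ (nor on $\Pi_1,\Pi_2$). *)

theory Defs
  imports "HOL-Analysis.Analysis"
begin

text \<open>Coefficients are indexed by \<open>k \<in> {1..N}\<close>; values of \<open>u\<close> and \<open>v\<close> at other
  indices are never used.\<close>

definition mean_step :: "nat \<Rightarrow> (nat \<Rightarrow> real) \<Rightarrow> (nat \<Rightarrow> real) \<Rightarrow> real" where
  "mean_step N u v = (\<Sum>k=1..N. real k * (u k + v k))"

definition decaying_input :: "real \<Rightarrow> real \<Rightarrow> (real \<Rightarrow> complex) \<Rightarrow> bool" where
  "decaying_input \<tau> P X \<longleftrightarrow>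
     continuous_on UNIV X \<and>
     (\<forall>t>0. cmod (X t) \<le> P * exp (- \<tau> * t)) \<and>
     (\<forall>t<0. X t = 0)"

definition delay_solution ::
  "nat \<Rightarrow> (nat \<Rightarrow> real) \<Rightarrow> (nat \<Rightarrow> real) \<Rightarrow> (real \<Rightarrow> complex) \<Rightarrow> (real \<Rightarrow> complex) \<Rightarrow>
   (real \<Rightarrow> complex) \<Rightarrow> (real \<Rightarrow> complex) \<Rightarrow> bool" where
  "delay_solution N u v X\<^sub>1 X\<^sub>2 Z\<^sub>1 Z\<^sub>2 \<longleftrightarrow>
     continuous_on UNIV Z\<^sub>1 \<and> continuous_on UNIV Z\<^sub>2 \<and>
     (\<forall>t>0. Z\<^sub>1 t = X\<^sub>1 t + (\<Sum>k=1..N. of_real (u k) * Z\<^sub>1 (t - real k)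
                                     + of_real (v k) * Z\<^sub>2 (t - real k))) \<and>
     (\<forall>t>0. Z\<^sub>2 t = X\<^sub>2 t + (\<Sum>k=1..N. of_real (u k) * Z\<^sub>2 (t - real k)
                                     + of_real (v k) * Z\<^sub>1 (t - real k))) \<and>
     (\<forall>t<0. Z\<^sub>1 t = 0) \<and> (\<forall>t<0. Z\<^sub>2 t = 0)"

text \<open>\<open>infsum\<close> is \<open>0\<close> on families that are not summable; statements using
  \<open>periodic_limit\<close> have to assert summability of \<open>periodic_limit_term\<close> separately.\<close>

definition periodic_limit_term ::
  "(real \<Rightarrow> complex) \<Rightarrow> (real \<Rightarrow> complex) \<Rightarrow> real \<Rightarrow> int \<Rightarrow> complex" where
  "periodic_limit_term X\<^sub>1 X\<^sub>2 t k =
     X\<^sub>1 (t - 2 * real_of_int k) + X\<^sub>2 (t - 2 * real_of_int k - 1)"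

definition periodic_limit ::
  "nat \<Rightarrow> (nat \<Rightarrow> real) \<Rightarrow> (nat \<Rightarrow> real) \<Rightarrow> (real \<Rightarrow> complex) \<Rightarrow> (real \<Rightarrow> complex) \<Rightarrow>
   real \<Rightarrow> complex" where
  "periodic_limit N u v X\<^sub>1 X\<^sub>2 t =
     of_real (1 / mean_step N u v) * (\<Sum>\<^sub>\<infinity>k\<in>UNIV. periodic_limit_term X\<^sub>1 X\<^sub>2 t k)"

end

(* Since w k = u k + v k, with u supported on even and v on odd indices, the two
   components decouple along parity: Z_1 t is the sum over n >= 0 of p n * Y_n (t - n), where
   Y_n is X_1 for even n and X_2 for odd n, and p is the renewal sequence of the probability
   weights w. By the renewal theorem p n tends to 1 / J, so Z_1 approaches the bi-infinite sum
   of Y_n (t - n) / J, which is s; the error is a convolution of p n - 1 / J with a geometric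
   sequence, plus the exponentially small terms with n < 0. Exchanging X_1 and X_2 gives Z_2.

   For the renewal theorem, let c be the upper limit of p and let p n be close to c. As p n is
   an average of earlier values, almost bounded by c, all values p (n - l) with l large are close
   to c, so the average property keeps all later values close to c as well. The value of c comes
   from the conserved quantity renewal_tail_sum. *)
theory Submission
  imports Defs
begin

section \<open>Additively closed sets of natural numbers\<close>

lemma additive_set_eventually_all:
  fixes S :: "nat set"
  assumes zero: "0 \<in> S" and add: "\<And>a b. a \<in> S \<Longrightarrow> b \<in> S \<Longrightarrow> a + b \<in> S" and gcd: "Gcd S = 1"
  shows "\<exists>L. \<forall>n\<ge>L. n \<in> S"
proof -
  have mult: "q * a \<in> S" if "a \<in> S" for q a
    using that by (induction q) (auto intro: zero add)
  have "\<not> S \<subseteq> {0}"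
    using gcd by (metis Gcd_0_iff zero_neq_one)
  then obtain s where s: "s \<in> S" "s > 0"
    by auto
  \<comment> \<open>The least difference of two elements of \<open>S\<close> divides every element, hence equals 1.\<close>
  define gap where "gap d \<longleftrightarrow> d > 0 \<and> (\<exists>a\<in>S. a + d \<in> S)" for d
  have gap_s: "gap s"
    unfolding gap_def using s zero by (auto intro!: bexI[of _ 0])
  define d where "d = (LEAST d. gap d)"
  have gap_d: "gap d"
    unfolding d_def using gap_s by (rule LeastI)
  then obtain a where a: "d > 0" "a \<in> S" "a + d \<in> S"
    by (auto simp: gap_def)
  have "d dvd n" if n: "n \<in> S" for n
  proof (rule ccontr)
    define q r where "q = n div d" and "r = n mod d"
    assume "\<not> d dvd n"
    then have "r > 0"
      by (auto simp: r_def dvd_eq_mod_eq_0)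
    \<comment> \<open>This exhibits \<open>r\<close> as a difference of two elements of
      \<open>S\<close> that is smaller than the least difference \<open>d\<close>.\<close>
    have "q * a + n = q * (a + d) + r"
      by (simp add: q_def r_def algebra_simps)
    moreover have "q * a + n \<in> S" "q * (a + d) \<in> S"
      using a n by (auto intro: add mult)
    ultimately have "gap r"
      using \<open>r > 0\<close> by (auto simp: gap_def)
    then have "d \<le> r"
      unfolding d_def by (rule Least_le)
    then show False
      using a(1) by (simp add: r_def not_less[symmetric])
  qed
  then have "d dvd Gcd S"
    by (rule Gcd_greatest)
  then have "d = 1"
    using gcd by simp
  with a have a1: "a + 1 \<in> S" by simp
  \<comment> \<open>From \<open>a * a\<close> on, the quotient by \<open>a\<close> exceeds the
    remainder \<open>r\<close>, so \<open>r\<close> of the copies of \<open>a\<close> can be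
    replaced by \<open>a + 1\<close>.\<close>
  have "n \<in> S" if n: "n \<ge> a * a" for n
  proof (cases "a = 0")
    case True
    then show ?thesis using mult[OF a1, of n] by simp
  next
    case False
    define q r where "q = n div a" and "r = n mod a"
    have "r < a" using False by (simp add: r_def)
    also have "a \<le> q"
      using n False by (simp add: q_def less_eq_div_iff_mult_less_eq)
    finally have "r \<le> q" by simp
    have "n = q * a + r" by (simp add: q_def r_def)
    also have "\<dots> = (q - r) * a + r * (a + 1)"
      using \<open>r \<le> q\<close> by (metis add.assoc add_mult_distrib le_add_diff_inverse2 mult.right_neutral distrib_left)
    finally show ?thesis
      using add[OF mult[OF a(2), of "q - r"] mult[OF a1, of r]] by simp
  qed
  then show ?thesis by blast
qed

section \<open>Renewal sequences and the renewal theorem\<close>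

text \<open>Double counting: \<open>f k\<close> occurs once for each \<open>j < k\<close>. With
  \<open>f = w\<close> this writes the mean step as a sum of tail probabilities.\<close>

lemma tail_weight_sum:
  fixes f :: "nat \<Rightarrow> real"
  shows "(\<Sum>j<N. \<Sum>k\<in>{j<..N}. f k) = (\<Sum>k=1..N. real k * f k)"
proof -
  have "(\<Sum>j<N. \<Sum>k\<in>{j<..N}. f k) = (\<Sum>j\<in>{..<N}. \<Sum>k | k \<in> {1..N} \<and> j < k. f k)"
    by (intro sum.cong) auto
  also have "\<dots> = (\<Sum>k=1..N. \<Sum>j | j \<in> {..<N} \<and> j < k. f k)"
    by (rule sum.swap_restrict) auto
  also have "\<dots> = (\<Sum>k=1..N. \<Sum>j<k. f k)"
    by (intro sum.cong) auto
  finally show ?thesis by simp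
qed

text \<open>The probability that \<open>n\<close> is a renewal time when the steps are distributed according to \<open>w\<close>.\<close>

function renewal_seq :: "(nat \<Rightarrow> real) \<Rightarrow> nat \<Rightarrow> real" where
  "renewal_seq w n = (if n = 0 then 1 else \<Sum>k=1..n. w k * renewal_seq w (n - k))"
  by auto
termination by (relation "Wellfounded.measure snd") auto

declare renewal_seq.simps [simp del]

text \<open>Vanishing outside \<open>{1..N}\<close> excludes steps of length 0 and makes sums over
  \<open>{1..n}\<close> and \<open>{1..N}\<close> comparable.\<close>

locale aperiodic_weights =
  fixes w :: "nat \<Rightarrow> real" and N :: nat
  assumes nonneg: "w k \<ge> 0"
    and support: "k \<notin> {1..N} \<Longrightarrow> w k = 0"
    and total: "(\<Sum>k=1..N. w k) = 1"
    and aperiodic: "Gcd {k. w k > 0} = 1"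
begin

abbreviation p :: "nat \<Rightarrow> real" where "p \<equiv> renewal_seq w"

definition J :: real where "J = (\<Sum>k=1..N. real k * w k)"

text \<open>Survival function of the step length.\<close>

definition tail :: "nat \<Rightarrow> real" where "tail j = (\<Sum>k\<in>{j<..N}. w k)"

lemma total_Suc_0 [simp]: "sum w {Suc 0..N} = 1"
  using total by simp

lemma p_0: "p 0 = 1"
  by (simp add: renewal_seq.simps)

lemma p_rec: "n > 0 \<Longrightarrow> p n = (\<Sum>k=1..n. w k * p (n - k))"
  by (subst renewal_seq.simps) simp

text \<open>The guard makes the sequence 0 before time 0; truncated subtraction alone would give
  every \<open>k > n\<close> the value \<open>p 0 = 1\<close>.\<close>

lemma p_rec_N:
  assumes "n > 0"
  shows "p n = (\<Sum>k=1..N. w k * (if k \<le> n then p (n - k) else 0))"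
proof -
  have "p n = (\<Sum>k\<in>{1..n} \<union> {1..N}. w k * (if k \<le> n then p (n - k) else 0))"
    unfolding p_rec[OF assms] by (rule sum.mono_neutral_cong_left) auto
  also have "\<dots> = (\<Sum>k=1..N. w k * (if k \<le> n then p (n - k) else 0))"
    by (rule sum.mono_neutral_right) (auto simp: support)
  finally show ?thesis .
qed

lemma p_nonneg: "p n \<ge> 0"
proof (induction n rule: less_induct)
  case (less n)
  then show ?case
    by (cases "n = 0") (auto simp: p_0 p_rec intro!: sum_nonneg mult_nonneg_nonneg nonneg)
qed

lemma p_le_1: "p n \<le> 1"
proof (induction n rule: less_induct)
  case (less n)
  show ?case
  proof (cases "n = 0")
    case False
    then have "p n = (\<Sum>k=1..N. w k * (if k \<le> n then p (n - k) else 0))"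
      by (simp add: p_rec_N)
    also have "\<dots> \<le> (\<Sum>k=1..N. w k * 1)"
      using less by (intro sum_mono mult_left_mono nonneg) auto
    finally show ?thesis by (simp add: total)
  qed (simp add: p_0)
qed

text \<open>A renewal at \<open>a\<close> and another one \<open>b\<close> later is only one of the
  ways to renew at \<open>a + b\<close>. The induction conditions on the first step.\<close>

lemma p_add: "p (a + b) \<ge> p a * p b"
proof (induction a rule: less_induct)
  case (less a)
  show ?case
  proof (cases "a = 0")
    case False
    then have "p a * p b = (\<Sum>k=1..a. w k * (p (a - k) * p b))"
      by (simp add: p_rec sum_distrib_right mult.assoc)
    also have "\<dots> \<le> (\<Sum>k=1..a. w k * p (a + b - k))"
    proof (intro sum_mono mult_left_mono nonneg)
      fix k assume "k \<in> {1..a}"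
      then show "p (a - k) * p b \<le> p (a + b - k)"
        using less[of "a - k"] by simp
    qed
    also have "\<dots> \<le> (\<Sum>k=1..a+b. w k * p (a + b - k))"
      by (intro sum_mono2) (auto intro!: mult_nonneg_nonneg nonneg p_nonneg)
    also have "\<dots> = p (a + b)"
      using False by (simp add: p_rec)
    finally show ?thesis .
  qed (simp add: p_0)
qed

lemma weight_le_p:
  assumes "k > 0" shows "w k \<le> p k"
proof -
  have "w k * p (k - k) \<le> (\<Sum>i=1..k. w i * p (k - i))"
    by (rule member_le_sum) (use assms in \<open>auto intro!: mult_nonneg_nonneg nonneg p_nonneg\<close>)
  then show ?thesis
    using assms by (simp add: p_rec p_0)
qed

text \<open>The set of \<open>n\<close> with \<open>p n > 0\<close> is closed under addition by
  \<open>p_add\<close> and contains the support of \<open>w\<close>, so its gcd is 1.\<close>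

lemma p_eventually_pos: "\<exists>L. \<forall>n\<ge>L. p n > 0"
proof -
  have "Gcd {n. p n > 0} dvd Gcd {k. w k > 0}"
  proof (rule Gcd_greatest)
    fix k assume "k \<in> {k. w k > 0}"
    then have "w k > 0" "k > 0"
      using support[of 0] by (auto intro: gr0I)
    then have "p k > 0"
      using weight_le_p[of k] by linarith
    then show "Gcd {n. p n > 0} dvd k" by (intro Gcd_dvd) simp
  qed
  then have "Gcd {n. p n > 0} = 1"
    by (simp add: aperiodic)
  moreover have "p (a + b) > 0" if "p a > 0" "p b > 0" for a b
    using p_add[of a b] that by (metis less_le_trans mult_pos_pos)
  ultimately show ?thesis
    using additive_set_eventually_all[of "{n. p n > 0}"] by (auto simp: p_0)
qed

text \<open>Repeated expansion of \<open>d (n + l)\<close> by the recurrence gives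
  \<open>d n\<close> the total weight \<open>p l\<close>, and the other terms are nonnegative. Hence
  a small late value of \<open>d\<close> forces small earlier values wherever \<open>p l\<close> is
  bounded below.\<close>

lemma p_mult_le_averaged:
  fixes d :: "nat \<Rightarrow> real"
  assumes d_nonneg: "\<And>n. n \<ge> n0 \<Longrightarrow> d n \<ge> 0"
    and d_rec: "\<And>n. n \<ge> n0 + N \<Longrightarrow> d n = (\<Sum>k=1..N. w k * d (n - k))"
    and n: "n \<ge> n0 + N"
  shows "p l * d n \<le> d (n + l)"
proof (induction l rule: less_induct)
  case (less l)
  show ?case
  proof (cases "l = 0")
    case False
    have "p l * d n = (\<Sum>k=1..N. w k * ((if k \<le> l then p (l - k) else 0) * d n))"
      using False by (subst p_rec_N) (simp_all add: sum_distrib_right mult.assoc)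
    also have "\<dots> \<le> (\<Sum>k=1..N. w k * d (n + l - k))"
    proof (intro sum_mono mult_left_mono nonneg)
      fix k assume k: "k \<in> {1..N}"
      show "(if k \<le> l then p (l - k) else 0) * d n \<le> d (n + l - k)"
        using k n less[of "l - k"] d_nonneg[of "n + l - k"] by auto
    qed
    also have "\<dots> = d (n + l)"
      using n by (subst (2) d_rec) auto
    finally show ?thesis .
  qed (simp add: p_0)
qed

text \<open>A minimum principle: averaging preserves lower bounds, so \<open>N\<close> consecutive
  values control all later ones.\<close>

lemma averaged_ge:
  fixes f :: "nat \<Rightarrow> real"
  assumes rec: "\<And>n. n \<ge> m + N \<Longrightarrow> f n = (\<Sum>k=1..N. w k * f (n - k))"
    and window: "\<And>n. m \<le> n \<Longrightarrow> n < m + N \<Longrightarrow> c \<le> f n"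
    and n: "m \<le> n"
  shows "c \<le> f n"
  using n
proof (induction n rule: less_induct)
  case (less n)
  show ?case
  proof (cases "n < m + N")
    case False
    have "c = (\<Sum>k=1..N. w k * c)"
      by (simp add: total sum_distrib_right[symmetric])
    also have "\<dots> \<le> (\<Sum>k=1..N. w k * f (n - k))"
      using False by (intro sum_mono mult_left_mono nonneg less) auto
    also have "\<dots> = f n"
      using False by (simp add: rec)
    finally show ?thesis .
  qed (use window less in auto)
qed

lemma p_convergent: "\<exists>c. p \<longlonglongrightarrow> c"
proof -
  \<comment> \<open>\<open>U\<close> collects the eventual upper bounds of \<open>p\<close>, so its
    infimum \<open>c\<close> is the limit superior.\<close>
  define U where "U = {B. \<forall>\<^sub>F n in sequentially. p n \<le> B}"
  define c where "c = Inf U"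
  have "1 \<in> U"
    by (simp add: U_def p_le_1)
  have U_ge: "0 \<le> B" if "B \<in> U" for B
  proof -
    from that obtain n where "p n \<le> B"
      by (auto simp: U_def eventually_sequentially)
    with p_nonneg[of n] show ?thesis by linarith
  qed
  then have bdd: "bdd_below U"
    by (auto simp: bdd_below_def)
  obtain L where L: "\<And>n. n \<ge> L \<Longrightarrow> p n > 0"
    using p_eventually_pos by auto
  have Npos: "N > 0"
    using total by (cases N) auto
  \<comment> \<open>A positive lower bound on \<open>N\<close> consecutive indices, the length of
    the starting window in \<open>averaged_ge\<close>.\<close>
  define \<delta> where "\<delta> = Min (p ` {L..<L+N})"
  have \<delta>: "\<delta> > 0" "\<And>l. L \<le> l \<Longrightarrow> l < L + N \<Longrightarrow> \<delta> \<le> p l"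
    unfolding \<delta>_def using Npos L by (auto)
  have upper: "\<forall>\<^sub>F n in sequentially. p n \<le> c + e" if "e > 0" for e
  proof -
    have "Inf U < c + e" using that by (simp add: c_def)
    then obtain B where "B \<in> U" "B < c + e"
      using \<open>1 \<in> U\<close> bdd by (subst (asm) cInf_less_iff) auto
    then show ?thesis
      by (auto simp: U_def elim!: eventually_mono)
  qed
  have lower: "\<forall>\<^sub>F n in sequentially. p n \<ge> c - 2 * e / \<delta>" if e: "e > 0" for e
  proof -
    obtain n0 where n0: "\<And>n. n \<ge> n0 \<Longrightarrow> p n \<le> c + e"
      using upper[OF e] by (auto simp: eventually_sequentially)
    have "c - e \<notin> U"
      using cInf_lower[OF _ bdd, of "c - e"] e by (auto simp: c_def)
    \<comment> \<open>As \<open>c - e\<close> is no eventual upper bound, such \<open>n\<close>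
      occur arbitrarily late. The offset keeps the window \<open>n - L - N < i \<le> n - L\<close>
      beyond \<open>n0 + N\<close>.\<close>
    then obtain n where n: "n \<ge> n0 + N + L + N" "p n > c - e"
      by (auto simp: U_def eventually_sequentially not_le)
    \<comment> \<open>The gap below \<open>c + e\<close> is nonnegative from \<open>n0\<close> on
      and inherits the recurrence of \<open>p\<close> because the weights sum to 1.\<close>
    define d where "d i = c + e - p i" for i
    have d_rec: "d i = (\<Sum>k=1..N. w k * d (i - k))" if "i \<ge> n0 + N" for i
    proof -
      have "p i = (\<Sum>k=1..N. w k * p (i - k))"
        using that Npos p_rec_N[of i] by auto
      then show ?thesis
        by (simp add: d_def right_diff_distrib sum_subtractf total sum_distrib_right[symmetric])
    qed
    \<comment> \<open>Here \<open>n - i\<close> lies in \<open>{L..<L+N}\<close>, so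
      \<open>p (n - i)\<close> is at least \<open>\<delta>\<close>, while
      \<open>d n < 2 * e\<close>.\<close>
    have "p i \<ge> c - 2 * e / \<delta>" if i: "n - L - N < i" "i \<le> n - L" for i
    proof -
      have "p (n - i) * d i \<le> d (i + (n - i))"
      proof (rule p_mult_le_averaged[where n = i and l = "n - i" and ?n0.0 = n0 and d = d])
        show "d m \<ge> 0" if "m \<ge> n0" for m
          using n0[OF that] by (simp add: d_def)
        show "i \<ge> n0 + N" using i n by simp
      qed (fact d_rec)
      also have "\<dots> \<le> 2 * e"
        using i n by (simp add: d_def)
      finally have "p (n - i) * d i \<le> 2 * e" .
      moreover have "\<delta> * d i \<le> p (n - i) * d i"
        using i n n0[of i] by (intro mult_right_mono \<delta>) (auto simp: d_def)
      ultimately have "d i \<le> 2 * e / \<delta>"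
        using \<delta> by (simp add: field_simps)
      then show ?thesis using e by (simp add: d_def)
    qed
    note window = this
    have "c - 2 * e / \<delta> \<le> p i" if "n - L - N + 1 \<le> i" for i
    proof (rule averaged_ge[OF _ _ that])
      fix m assume "n - L - N + 1 + N \<le> m"
      then have "m > 0" "N \<le> m" by simp_all
      then show "p m = (\<Sum>k=1..N. w k * p (m - k))"
        unfolding p_rec_N[OF \<open>m > 0\<close>] by (intro sum.cong) auto
    next
      fix m assume "n - L - N + 1 \<le> m" "m < n - L - N + 1 + N"
      then show "c - 2 * e / \<delta> \<le> p m"
        using n by (intro window) auto
    qed
    then show ?thesis
      by (auto simp: eventually_sequentially)
  qed
  have "p \<longlonglongrightarrow> c"
  proof (rule order_tendstoI)
    fix a assume "a < c"
    \<comment> \<open>With this \<open>e\<close> the lower bound becomes the midpoint of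
      \<open>a\<close> and \<open>c\<close>.\<close>
    then have "\<forall>\<^sub>F n in sequentially. p n \<ge> c - 2 * ((c - a) * \<delta> / 4) / \<delta>"
      using \<delta>(1) by (intro lower) auto
    moreover have "a < c - 2 * ((c - a) * \<delta> / 4) / \<delta>"
    proof -
      have "c - 2 * ((c - a) * \<delta> / 4) / \<delta> = (c + a) / 2"
        using \<delta>(1) by (simp add: field_simps)
      then show ?thesis
        using \<open>a < c\<close> by simp
    qed
    ultimately show "\<forall>\<^sub>F n in sequentially. a < p n"
      by (auto elim!: eventually_mono intro: less_le_trans)
  next
    fix a assume "c < a"
    then have "\<forall>\<^sub>F n in sequentially. p n \<le> c + (a - c) / 2"
      by (intro upper) auto
    then show "\<forall>\<^sub>F n in sequentially. p n < a"
      by eventually_elim (use \<open>c < a\<close> in \<open>simp add: field_simps\<close>)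
  qed
  then show ?thesis ..
qed

lemma tail_0: "tail 0 = 1"
proof -
  have "{0<..N} = {1..N}" by auto
  then show ?thesis by (simp add: tail_def)
qed

lemma tail_Suc: "tail (Suc j) = tail j - w (Suc j)"
proof (cases "Suc j \<le> N")
  case True
  then have "{j<..N} = insert (Suc j) {Suc j<..N}" by auto
  then show ?thesis by (simp add: tail_def)
next
  case False
  then show ?thesis by (simp add: tail_def support)
qed

text \<open>\<open>tail j * p (n - j)\<close> is the probability that the last renewal up to time \<open>n\<close>
  occurs at time \<open>n - j\<close>.\<close>
lemma renewal_tail_sum: "(\<Sum>j\<le>n. tail j * p (n - j)) = 1"
proof (induction n)
  case (Suc n)
  have "(\<Sum>j\<le>Suc n. tail j * p (Suc n - j))
      = p (Suc n) + (\<Sum>j\<le>n. tail (Suc j) * p (n - j))"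
    by (subst sum.atMost_Suc_shift) (simp add: tail_0)
  also have "(\<Sum>j\<le>n. tail (Suc j) * p (n - j))
      = 1 - (\<Sum>j\<le>n. w (Suc j) * p (n - j))"
    by (simp add: tail_Suc left_diff_distrib sum_subtractf Suc.IH)
  also have "(\<Sum>j\<le>n. w (Suc j) * p (n - j)) = p (Suc n)"
    unfolding p_rec[OF zero_less_Suc]
    by (rule sum.reindex_bij_witness[of _ "\<lambda>k. k - 1" Suc]) auto
  finally show ?case by simp
qed (simp add: tail_0 p_0)

lemma J_pos: "J > 0"
proof -
  have "1 = (\<Sum>k=1..N. w k)" by (simp add: total)
  also have "\<dots> \<le> J"
    unfolding J_def
  proof (rule sum_mono)
    fix k assume "k \<in> {1..N}"
    then show "w k \<le> real k * w k"
      using mult_right_mono[of 1 "real k" "w k"] nonneg by simp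
  qed
  finally show ?thesis by simp
qed

text \<open>For \<open>n \<ge> N\<close> only the terms \<open>j < N\<close> of the conserved sum
  survive, so the limit can be taken termwise and gives \<open>J * c = 1\<close>.\<close>

theorem renewal_limit: "p \<longlonglongrightarrow> 1 / J"
proof -
  obtain c where c: "p \<longlonglongrightarrow> c"
    using p_convergent by auto
  have tail_eq: "(\<Sum>j<N. tail j * p (n - j)) = 1" if "n \<ge> N" for n
  proof -
    have "(\<Sum>j<N. tail j * p (n - j)) = (\<Sum>j\<le>n. tail j * p (n - j))"
      using that by (intro sum.mono_neutral_left) (auto simp: tail_def)
    then show ?thesis by (simp add: renewal_tail_sum)
  qed
  have "(\<lambda>n. p (n - j)) \<longlonglongrightarrow> c" for j
    by (rule LIMSEQ_offset[of _ j]) (simp add: c)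
  then have "(\<lambda>n. \<Sum>j<N. tail j * p (n - j)) \<longlonglongrightarrow> (\<Sum>j<N. tail j * c)"
    by (intro tendsto_intros)
  moreover have "(\<lambda>n. \<Sum>j<N. tail j * p (n - j)) \<longlonglongrightarrow> 1"
    by (rule tendsto_eventually) (auto simp: eventually_sequentially intro: tail_eq)
  ultimately have "(\<Sum>j<N. tail j * c) = 1"
    by (rule LIMSEQ_unique)
  then have "J * c = 1"
    unfolding J_def tail_weight_sum[symmetric] tail_def by (simp only: sum_distrib_right)
  then have "c = 1 / J"
    using J_pos by (simp add: field_simps)
  with c show ?thesis by simp
qed

end

section \<open>Inputs near the origin and uniqueness of solutions\<close>

text \<open>Inputs and solutions are prescribed only for \<open>t > 0\<close> and
  \<open>t < 0\<close>; the limit from the left supplies the value at 0.\<close>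

lemma continuous_vanishes_at_0:
  fixes f :: "real \<Rightarrow> 'a::t2_space"
  assumes "continuous_on UNIV f" "\<And>t. t < 0 \<Longrightarrow> f t = c"
  shows "f 0 = c"
proof (rule tendsto_unique)
  show "(f \<longlongrightarrow> f 0) (at_left 0)"
    using assms(1) by (auto simp: continuous_on_def filterlim_at_split)
  show "(f \<longlongrightarrow> c) (at_left 0)"
    by (rule tendsto_eventually) (use assms(2) in \<open>auto simp: eventually_at_left_field intro: exI[of _ "-1"]\<close>)
qed simp

lemma decaying_input_eq_0:
  assumes "decaying_input \<tau> P X" "t \<le> 0"
  shows "X t = 0"
  using assms continuous_vanishes_at_0[of X 0] unfolding decaying_input_def
  by (cases "t = 0") auto

text \<open>The enlarged constant \<open>Q\<close> lets two inputs share one bound.\<close>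

lemma decaying_input_bound:
  assumes "decaying_input \<tau> P X" "P \<ge> 0" "P \<le> Q"
  shows "cmod (X t) \<le> Q * exp (- \<tau> * \<bar>t\<bar>)"
proof (cases "t > 0")
  case True
  then have "cmod (X t) \<le> P * exp (- \<tau> * t)"
    using assms by (simp add: decaying_input_def)
  also have "\<dots> \<le> Q * exp (- \<tau> * t)"
    using assms by (intro mult_right_mono) auto
  finally show ?thesis using True by simp
next
  case False
  then show ?thesis
    using assms by (simp add: decaying_input_eq_0)
qed

text \<open>Method of steps: all delays are at least 1, so the values up to \<open>m\<close>
  determine those up to \<open>m + 1\<close>.\<close>

lemma delay_solution_unique:
  assumes Z: "delay_solution N u v X Y Z\<^sub>1 Z\<^sub>2" and W: "delay_solution N u v X Y W\<^sub>1 W\<^sub>2"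
  shows "Z\<^sub>1 = W\<^sub>1 \<and> Z\<^sub>2 = W\<^sub>2"
proof -
  have "\<forall>t\<le>real m. Z\<^sub>1 t = W\<^sub>1 t \<and> Z\<^sub>2 t = W\<^sub>2 t" for m
  proof (induction m)
    case 0
    have "Z\<^sub>1 0 = 0" "Z\<^sub>2 0 = 0" "W\<^sub>1 0 = 0" "W\<^sub>2 0 = 0"
      using Z W unfolding delay_solution_def
      by (metis continuous_vanishes_at_0)+
    then show ?case
      using Z W unfolding delay_solution_def by (metis le_less of_nat_0)
  next
    case (Suc m)
    have "Z\<^sub>1 t = W\<^sub>1 t \<and> Z\<^sub>2 t = W\<^sub>2 t" if t: "t \<le> real (Suc m)" "t > 0" for t
    proof -
      have "Z\<^sub>1 (t - real k) = W\<^sub>1 (t - real k)" "Z\<^sub>2 (t - real k) = W\<^sub>2 (t - real k)"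
        if "k \<in> {1..N}" for k
        using Suc.IH t that by auto
      then show ?thesis
        using Z W t unfolding delay_solution_def by simp
    qed
    then show ?case
      using Suc.IH by (metis not_less of_nat_0_le_iff order_trans)
  qed
  then show ?thesis
    by (metis ext real_arch_simple)
qed

section \<open>Exponential series and geometric convolutions\<close>

lemma summable_on_exp_abs_int:
  assumes "\<tau> > (0::real)"
  shows "(\<lambda>n::int. exp (- \<tau> * \<bar>real_of_int n\<bar>)) summable_on UNIV"
proof -
  have *: "(\<lambda>n. exp (- \<tau> * real n)) summable_on UNIV"
  proof (rule norm_summable_imp_summable_on)
    have "exp (- \<tau> * real n) = exp (- \<tau>) ^ n" for n
      using exp_of_nat_mult[of n "-\<tau>"] by (simp add: mult_ac)
    then show "summable (\<lambda>n. norm (exp (- \<tau> * real n)))"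
      using assms by (simp add: summable_geometric)
  qed
  have "(\<lambda>n. exp (- \<tau> * \<bar>real_of_int n\<bar>)) summable_on (range int)"
    by (subst summable_on_reindex) (use * in \<open>auto simp: o_def inj_on_def\<close>)
  moreover have "(\<lambda>n. exp (- \<tau> * \<bar>real_of_int n\<bar>)) summable_on (range (\<lambda>n. - int n))"
    by (subst summable_on_reindex) (use * in \<open>auto simp: o_def inj_on_def\<close>)
  moreover have "UNIV = range int \<union> range (\<lambda>n. - int n)"
  proof -
    have "n \<in> range int \<union> range (\<lambda>n. - int n)" for n
      by (cases n rule: int_cases2) auto
    then show ?thesis by blast
  qed
  ultimately show ?thesis
    using summable_on_union by metis
qed

text \<open>Reversing the order of summation moves the shift onto \<open>e\<close>; Tannery's
  theorem then applies with majorant \<open>E * r ^ k\<close>.\<close>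

lemma geometric_convolution_tendsto_0:
  fixes e :: "nat \<Rightarrow> real" and r :: real
  assumes e: "e \<longlonglongrightarrow> 0" and r: "0 \<le> r" "r < 1"
  shows "(\<lambda>m. \<Sum>n\<le>m. e n * r ^ (m - n)) \<longlonglongrightarrow> 0"
proof -
  obtain E where E: "\<And>n. \<bar>e n\<bar> \<le> E"
    using convergent_imp_Bseq[of e] e by (auto simp: convergent_def Bseq_def)
  define a where "a k m = (if k \<le> m then e (m - k) * r ^ k else 0)" for k m
  have "(\<lambda>m. \<Sum>k. a k m) \<longlonglongrightarrow> (\<Sum>k. (0::real))"
  proof (rule tannerys_theorem[THEN conjunct2, THEN conjunct2])
    fix k
    have "(\<lambda>m. e (m - k) * r ^ k) \<longlonglongrightarrow> 0"
      by (rule LIMSEQ_offset[of _ k]) (auto intro: tendsto_mult_left_zero e)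
    then show "a k \<longlonglongrightarrow> 0"
      by (rule Lim_transform_eventually)
         (auto simp: a_def eventually_sequentially)
  next
    have "0 \<le> E" using E[of 0] by linarith
    then show "\<forall>\<^sub>F (k, m) in at_top \<times>\<^sub>F sequentially. norm (a k m) \<le> E * r ^ k"
      by (intro always_eventually)
         (auto simp: a_def abs_mult r power_abs intro!: mult_mono E mult_nonneg_nonneg)
  qed (use r in \<open>auto intro!: summable_mult summable_geometric\<close>)
  moreover have "(\<Sum>k. a k m) = (\<Sum>n\<le>m. e n * r ^ (m - n))" for m
  proof -
    have "(\<Sum>k. a k m) = (\<Sum>k\<le>m. a k m)"
      by (rule suminf_finite) (auto simp: a_def)
    also have "\<dots> = (\<Sum>n\<le>m. e n * r ^ (m - n))"
      by (rule sum.reindex_bij_witness[of _ "\<lambda>k. m - k" "\<lambda>k. m - k"]) (auto simp: a_def)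
    finally show ?thesis .
  qed
  ultimately show ?thesis by simp
qed

section \<open>The alternating bi-infinite sum behind the periodic limit\<close>

text \<open>Unfolds \<open>periodic_limit_term\<close> into unit steps: the indices
  \<open>2 * k\<close> and \<open>2 * k + 1\<close> carry its two summands.\<close>

definition alt_term :: "(real \<Rightarrow> complex) \<Rightarrow> (real \<Rightarrow> complex) \<Rightarrow> real \<Rightarrow> int \<Rightarrow> complex" where
  "alt_term X Y t n = (if even n then X else Y) (t - real_of_int n)"

text \<open>Odd shifts exchange the inputs, just as odd delays couple the two components.\<close>

lemma alt_term_shift:
  "alt_term X Y t (n + int k) =
     (if even k then alt_term X Y else alt_term Y X) (t - real k) n"
  by (auto simp: alt_term_def algebra_simps)

text \<open>Turns the limit of the second component, formed with exchanged inputs, into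
  \<open>s (t - 1)\<close>; used twice, it gives period 2.\<close>

lemma infsum_alt_term_shift:
  "infsum (alt_term Y X t) UNIV = infsum (alt_term X Y (t - 1)) UNIV"
proof -
  have "bij (\<lambda>n::int. n + 1)"
    by (rule bij_betw_byWitness[where f' = "\<lambda>n. n - 1"]) auto
  then have "infsum (alt_term Y X t) UNIV = infsum (\<lambda>n. alt_term Y X t (n + 1)) UNIV"
    by (rule infsum_reindex_bij_betw[symmetric])
  also have "(\<lambda>n. alt_term Y X t (n + 1)) = alt_term X Y (t - 1)"
    using alt_term_shift[of Y X t _ 1] by auto
  finally show ?thesis .
qed

text \<open>The assumptions are symmetric in \<open>X\<close> and \<open>Y\<close>, so results for
  the first component pass to the second by exchanging the inputs.\<close>

locale exponentially_bounded_pair =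
  fixes \<tau> P :: real and X Y :: "real \<Rightarrow> complex"
  assumes \<tau>_pos: "\<tau> > 0" and P_nonneg: "P \<ge> 0"
    and cont_X: "continuous_on UNIV X" and cont_Y: "continuous_on UNIV Y"
    and X_bound: "cmod (X t) \<le> P * exp (- \<tau> * \<bar>t\<bar>)"
    and Y_bound: "cmod (Y t) \<le> P * exp (- \<tau> * \<bar>t\<bar>)"
    and X_eq_0: "t \<le> 0 \<Longrightarrow> X t = 0" and Y_eq_0: "t \<le> 0 \<Longrightarrow> Y t = 0"
begin

lemma swap: "exponentially_bounded_pair \<tau> P Y X"
  using \<tau>_pos P_nonneg cont_X cont_Y X_bound Y_bound X_eq_0 Y_eq_0 by unfold_locales

lemma alt_term_eq_0: "t \<le> real_of_int n \<Longrightarrow> alt_term X Y t n = 0"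
  by (simp add: alt_term_def X_eq_0 Y_eq_0)

lemma alt_term_bound: "cmod (alt_term X Y t n) \<le> P * exp (- \<tau> * \<bar>t - real_of_int n\<bar>)"
  using X_bound Y_bound by (auto simp: alt_term_def)

text \<open>The triangle inequality removes \<open>t\<close> from the exponent, leaving a majorant
  in \<open>n\<close> alone for the Weierstrass test.\<close>

lemma alt_term_bound_local:
  assumes "\<bar>t\<bar> \<le> A"
  shows "cmod (alt_term X Y t n) \<le> P * exp (\<tau> * A) * exp (- \<tau> * \<bar>real_of_int n\<bar>)"
proof -
  have "\<tau> * \<bar>real_of_int n\<bar> \<le> \<tau> * (\<bar>t - real_of_int n\<bar> + A)"
    using assms \<tau>_pos by (intro mult_left_mono) auto
  then have "exp (- \<tau> * \<bar>t - real_of_int n\<bar>) \<le> exp (\<tau> * A) * exp (- \<tau> * \<bar>real_of_int n\<bar>)"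
    by (simp add: exp_add[symmetric] algebra_simps)
  then have "P * exp (- \<tau> * \<bar>t - real_of_int n\<bar>) \<le> P * exp (\<tau> * A) * exp (- \<tau> * \<bar>real_of_int n\<bar>)"
    unfolding mult.assoc by (intro mult_left_mono P_nonneg)
  then show ?thesis
    using alt_term_bound order_trans by blast
qed

lemma summable_on_bound: "(\<lambda>n::int. c * exp (- \<tau> * \<bar>real_of_int n\<bar>)) summable_on UNIV"
  by (intro summable_on_cmult_right summable_on_exp_abs_int \<tau>_pos)

lemma abs_summable_alt_term: "(\<lambda>n. norm (alt_term X Y t n)) summable_on UNIV"
  by (rule Infinite_Sum.abs_summable_on_comparison_test'[OF summable_on_bound[of "P * exp (\<tau> * \<bar>t\<bar>)"]])
     (rule alt_term_bound_local, simp)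

lemma summable_alt_term: "alt_term X Y t summable_on A"
  using abs_summable_summable[OF abs_summable_alt_term] summable_on_subset_banach by blast

lemma continuous_infsum_alt_term: "continuous_on UNIV (\<lambda>t. infsum (alt_term X Y t) UNIV)"
proof -
  \<comment> \<open>The majorant is uniform only for bounded \<open>t\<close>; this suffices because
    continuity is local.\<close>
  have "continuous_on {-A<..<A} (\<lambda>t. infsum (alt_term X Y t) UNIV)" for A
  proof (rule uniform_limit_theorem)
    show "uniform_limit {-A<..<A} (\<lambda>F t. \<Sum>n\<in>F. alt_term X Y t n)
            (\<lambda>t. \<Sum>\<^sub>\<infinity>n. alt_term X Y t n) (finite_subsets_at_top UNIV)"
      by (rule Weierstrass_m_test_general[OF _ summable_on_bound[of "P * exp (\<tau> * A)"]])
         (rule alt_term_bound_local, auto)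
    show "\<forall>\<^sub>F F in finite_subsets_at_top UNIV. continuous_on {-A<..<A} (\<lambda>t. \<Sum>n\<in>F. alt_term X Y t n)"
      unfolding alt_term_def
      by (intro always_eventually allI continuous_on_sum)
         (auto intro!: continuous_on_compose2[OF cont_X] continuous_on_compose2[OF cont_Y] continuous_intros)
  qed simp
  then have "isCont (\<lambda>t. infsum (alt_term X Y t) UNIV) t" for t
    by (rule continuous_on_interior[of "{-(\<bar>t\<bar> + 1)<..<\<bar>t\<bar> + 1}"]) (simp add: interior_open, linarith)
  then show ?thesis
    by (simp add: continuous_at_imp_continuous_on)
qed

text \<open>Even and odd indices are summed separately, each reindexed by \<open>k\<close>, and then
  paired; every subfamily of \<open>alt_term\<close> is summable.\<close>

lemma has_sum_periodic_limit_term: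
  "(periodic_limit_term X Y t has_sum infsum (alt_term X Y t) UNIV) UNIV"
proof -
  let ?E = "range (\<lambda>k::int. 2 * k)" and ?O = "range (\<lambda>k::int. 2 * k + 1)"
  have "(alt_term X Y t has_sum infsum (alt_term X Y t) ?E) ?E"
       "(alt_term X Y t has_sum infsum (alt_term X Y t) ?O) ?O"
    by (intro has_sum_infsum summable_alt_term)+
  moreover have UN: "?E \<union> ?O = UNIV"
  proof -
    have "n \<in> ?E \<union> ?O" for n :: int
      by (cases "even n") (auto elim!: evenE oddE)
    then show ?thesis by blast
  qed
  moreover have disj: "?E \<inter> ?O = {}"
    by (auto; presburger)
  ultimately have "infsum (alt_term X Y t) UNIV
      = infsum (alt_term X Y t) ?E + infsum (alt_term X Y t) ?O"
    by (metis has_sum_Un_disjoint infsumI)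
  moreover have "((\<lambda>k. X (t - 2 * real_of_int k)) has_sum infsum (alt_term X Y t) ?E) UNIV"
    using has_sum_infsum[OF summable_alt_term[of t ?E]]
    by (subst (asm) has_sum_reindex) (auto simp: o_def alt_term_def inj_on_def)
  moreover have "((\<lambda>k. Y (t - 2 * real_of_int k - 1)) has_sum infsum (alt_term X Y t) ?O) UNIV"
    using has_sum_infsum[OF summable_alt_term[of t ?O]]
    by (subst (asm) has_sum_reindex) (auto simp: o_def alt_term_def inj_on_def algebra_simps)
  ultimately show ?thesis
    unfolding periodic_limit_term_def by (simp add: has_sum_add)
qed

lemma periodic_limit_eq:
  "periodic_limit N u v X Y t = of_real (1 / mean_step N u v) * infsum (alt_term X Y t) UNIV"
  unfolding periodic_limit_def using has_sum_periodic_limit_term[THEN infsumI] by simp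

text \<open>Indices above \<open>M\<close> meet the inputs at negative arguments and drop out. The
  finite part has the index range of the renewal solution.\<close>

lemma infsum_alt_term_split:
  assumes "t \<le> real M"
  shows "infsum (alt_term X Y t) UNIV
    = (\<Sum>n\<le>M. alt_term X Y t (int n)) + infsum (alt_term X Y t) {..<0}"
proof -
  have "infsum (alt_term X Y t) UNIV = infsum (alt_term X Y t) (int ` {..M} \<union> {..<0})"
  proof (rule infsum_cong_neutral)
    fix n :: int assume "n \<in> UNIV - (int ` {..M} \<union> {..<0})"
    then have "n \<notin> int ` {..M}" "0 \<le> n" by auto
    then have "n > int M"
      by (metis atMost_iff image_eqI nonneg_int_cases not_less of_nat_le_iff)
    then show "alt_term X Y t n = 0"
      using assms by (intro alt_term_eq_0) linarith
  qed auto
  also have "\<dots> = infsum (alt_term X Y t) (int ` {..M}) + infsum (alt_term X Y t) {..<0}"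
    by (intro infsum_Un_disjoint summable_alt_term) auto
  also have "infsum (alt_term X Y t) (int ` {..M}) = (\<Sum>n\<le>M. alt_term X Y t (int n))"
    by (simp add: sum.reindex inj_on_def)
  finally show ?thesis .
qed

text \<open>For \<open>n < 0\<close> the distance from \<open>t\<close> to \<open>n\<close> is the
  sum of their absolute values, so \<open>exp (- \<tau> * t)\<close> factors out.\<close>

lemma infsum_alt_term_negative_bound:
  assumes "t \<ge> 0"
  shows "cmod (infsum (alt_term X Y t) {..<0})
    \<le> P * exp (- \<tau> * t) * infsum (\<lambda>n. exp (- \<tau> * \<bar>real_of_int n\<bar>)) {..<0}"
proof (rule norm_infsum_le)
  show "(alt_term X Y t has_sum infsum (alt_term X Y t) {..<0}) {..<0}"
    by (intro has_sum_infsum summable_alt_term)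
  have "(\<lambda>n. exp (- \<tau> * \<bar>real_of_int n\<bar>)) summable_on {..<0}"
    using summable_on_exp_abs_int[OF \<tau>_pos] summable_on_subset_banach by blast
  then show "((\<lambda>n. P * exp (- \<tau> * t) * exp (- \<tau> * \<bar>real_of_int n\<bar>)) has_sum
     P * exp (- \<tau> * t) * infsum (\<lambda>n. exp (- \<tau> * \<bar>real_of_int n\<bar>)) {..<0}) {..<0}"
    by (intro has_sum_cmult_right has_sum_infsum)
  fix n :: int assume "n \<in> {..<0}"
  then have "exp (- \<tau> * \<bar>t - real_of_int n\<bar>) = exp (- \<tau> * t) * exp (- \<tau> * \<bar>real_of_int n\<bar>)"
    using assms by (simp add: exp_add[symmetric] algebra_simps)
  then show "cmod (alt_term X Y t n) \<le> P * exp (- \<tau> * t) * exp (- \<tau> * \<bar>real_of_int n\<bar>)"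
    using alt_term_bound[of t n] by (simp only: mult.assoc)
qed

end

section \<open>The renewal solution and its error rate\<close>

context aperiodic_weights
begin

text \<open>A truncated series: for inputs vanishing at nonpositive arguments, all omitted terms are
  0.\<close>

definition renewal_sol :: "(real \<Rightarrow> complex) \<Rightarrow> (real \<Rightarrow> complex) \<Rightarrow> real \<Rightarrow> complex" where
  "renewal_sol X Y t = (\<Sum>n\<le>nat \<lceil>t\<rceil>. of_real (p n) * alt_term X Y t (int n))"

text \<open>The first sum measures the deviation of \<open>p\<close> from its limit, the second the
  negative indices that occur in \<open>s\<close> but not in \<open>renewal_sol\<close>. No input
  enters, so this can serve as \<open>C\<close>.\<close>

definition error_rate :: "real \<Rightarrow> real \<Rightarrow> real" where
  "error_rate \<tau> t =
     (\<Sum>n\<le>nat \<lceil>t\<rceil>. \<bar>p n - 1 / J\<bar> * exp (- \<tau> * \<bar>t - real n\<bar>))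
     + 1 / J * (exp (- \<tau> * t) * (\<Sum>\<^sub>\<infinity>n\<in>{..<0}. exp (- \<tau> * \<bar>real_of_int n\<bar>)))"

lemma error_rate_tendsto_0:
  assumes "\<tau> > 0"
  shows "(error_rate \<tau> \<longlongrightarrow> 0) at_top"
proof -
  define r where "r = exp (- \<tau>)"
  define a where "a m = (\<Sum>n\<le>m. \<bar>p n - 1 / J\<bar> * r ^ (m - n))" for m
  have "(\<lambda>n. \<bar>p n - 1 / J\<bar>) \<longlonglongrightarrow> 0"
    using renewal_limit by (simp add: LIM_zero tendsto_rabs_zero)
  then have "a \<longlonglongrightarrow> 0"
    unfolding a_def using assms by (intro geometric_convolution_tendsto_0) (auto simp: r_def)
  moreover have ceil: "filterlim (\<lambda>t::real. nat \<lceil>t\<rceil>) sequentially at_top"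
    unfolding filterlim_at_top
  proof
    fix Z :: nat
    show "\<forall>\<^sub>F t::real in at_top. Z \<le> nat \<lceil>t\<rceil>"
      by (rule eventually_mono[OF eventually_ge_at_top[of "real Z"]]) linarith
  qed
  ultimately have "((\<lambda>t::real. a (nat \<lceil>t\<rceil>)) \<longlongrightarrow> 0) at_top"
    by (rule filterlim_compose)
  \<comment> \<open>The factor \<open>exp \<tau>\<close> pays for rounding \<open>t\<close> up to an
    integer.\<close>
  then have upper: "((\<lambda>t::real. exp \<tau> * a (nat \<lceil>t\<rceil>)) \<longlongrightarrow> 0) at_top"
    using tendsto_mult_left[of _ 0 at_top "exp \<tau>"] by simp
  have "((\<lambda>t. \<Sum>n\<le>nat \<lceil>t\<rceil>. \<bar>p n - 1 / J\<bar> * exp (- \<tau> * \<bar>t - real n\<bar>)) \<longlongrightarrow> 0) at_top"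
  proof (rule tendsto_sandwich[OF _ _ tendsto_const upper])
    show "\<forall>\<^sub>F t in at_top. (\<Sum>n\<le>nat \<lceil>t\<rceil>. \<bar>p n - 1 / J\<bar> * exp (- \<tau> * \<bar>t - real n\<bar>))
            \<le> exp \<tau> * a (nat \<lceil>t\<rceil>)"
    proof (rule eventually_mono[OF eventually_gt_at_top[of 0]])
      fix t :: real assume "t > 0"
      define M where "M = nat \<lceil>t\<rceil>"
      have M: "real M \<le> t + 1"
        using \<open>t > 0\<close> unfolding M_def by linarith
      have "(\<Sum>n\<le>M. \<bar>p n - 1 / J\<bar> * exp (- \<tau> * \<bar>t - real n\<bar>))
          \<le> (\<Sum>n\<le>M. \<bar>p n - 1 / J\<bar> * (exp \<tau> * r ^ (M - n)))"
      proof (intro sum_mono mult_left_mono)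
        fix n assume "n \<in> {..M}"
        then have "\<tau> * real (M - n) \<le> \<tau> * (\<bar>t - real n\<bar> + 1)"
          using M assms by (intro mult_left_mono) auto
        then have "- \<tau> * \<bar>t - real n\<bar> \<le> \<tau> + real (M - n) * (- \<tau>)"
          by (simp add: algebra_simps)
        then have "exp (- \<tau> * \<bar>t - real n\<bar>) \<le> exp (\<tau> + real (M - n) * (- \<tau>))"
          by simp
        then show "exp (- \<tau> * \<bar>t - real n\<bar>) \<le> exp \<tau> * r ^ (M - n)"
          unfolding exp_add exp_of_nat_mult r_def .
      qed simp
      also have "\<dots> = exp \<tau> * a M"
        by (simp add: a_def sum_distrib_left mult_ac)
      finally show "(\<Sum>n\<le>nat \<lceil>t\<rceil>. \<bar>p n - 1 / J\<bar> * exp (- \<tau> * \<bar>t - real n\<bar>))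
            \<le> exp \<tau> * a (nat \<lceil>t\<rceil>)" by (simp add: M_def)
    qed
  qed (auto intro!: always_eventually sum_nonneg)
  moreover have "((\<lambda>t. exp (- \<tau> * t)) \<longlongrightarrow> 0) at_top"
    using assms by real_asymp
  then have "((\<lambda>t. 1 / J * (exp (- \<tau> * t) * (\<Sum>\<^sub>\<infinity>n\<in>{..<0}. exp (- \<tau> * \<bar>real_of_int n\<bar>)))) \<longlongrightarrow> 0) at_top"
    by (intro tendsto_mult_right_zero tendsto_mult_left_zero)
  ultimately show ?thesis
    unfolding error_rate_def using tendsto_add_zero by blast
qed

end

section \<open>The renewal solution solves the delay system\<close>

locale renewal_system = aperiodic_weights w N + exponentially_bounded_pair \<tau> P X Y
  for w N \<tau> P X Y
begin

text \<open>The freedom in \<open>M\<close> provides one truncation for all nearby times and delayed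
  arguments.\<close>

lemma renewal_sol_eq:
  assumes "t \<le> real M"
  shows "renewal_sol X Y t = (\<Sum>n\<le>M. of_real (p n) * alt_term X Y t (int n))"
  unfolding renewal_sol_def
proof (rule sum.mono_neutral_left)
  show "{..nat \<lceil>t\<rceil>} \<subseteq> {..M}"
    using assms by (auto simp: ceiling_le_iff nat_le_iff)
  show "\<forall>n\<in>{..M} - {..nat \<lceil>t\<rceil>}. of_real (p n) * alt_term X Y t (int n) = 0"
  proof
    fix n assume "n \<in> {..M} - {..nat \<lceil>t\<rceil>}"
    then have "t \<le> real_of_int (int n)" by simp linarith
    then show "of_real (p n) * alt_term X Y t (int n) = 0"
      by (simp add: alt_term_eq_0)
  qed
qed simp

lemma renewal_sol_eq_0: "t \<le> 0 \<Longrightarrow> renewal_sol X Y t = 0"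
  by (subst renewal_sol_eq[of _ 0]) (simp_all add: alt_term_eq_0)

lemma continuous_renewal_sol: "continuous_on UNIV (renewal_sol X Y)"
proof -
  have "isCont (renewal_sol X Y) t" for t
  proof -
    obtain M :: nat where M: "t < real M"
      using reals_Archimedean2 by blast
    have "continuous_on {..<real M} (\<lambda>t. \<Sum>n\<le>M. of_real (p n) * alt_term X Y t (int n))"
      unfolding alt_term_def
      by (intro continuous_on_sum continuous_on_mult continuous_on_const)
         (auto intro!: continuous_on_compose2[OF cont_X] continuous_on_compose2[OF cont_Y] continuous_intros)
    then have "continuous_on {..<real M} (renewal_sol X Y)"
      by (subst continuous_on_cong[OF refl renewal_sol_eq]) auto
    then show ?thesis
      using M by (auto simp: continuous_on_eq_continuous_at)
  qed
  then show ?thesis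
    by (simp add: continuous_at_imp_continuous_on)
qed

text \<open>Compare coefficients: indices up to \<open>M\<close> carry \<open>p n - 1 / J\<close>
  and form \<open>S\<close>, the negative ones keep \<open>1 / J\<close> and form
  \<open>R\<close>.\<close>

lemma renewal_sol_bound:
  assumes "t > 0"
  shows "cmod (renewal_sol X Y t - of_real (1 / J) * infsum (alt_term X Y t) UNIV)
    \<le> P * error_rate \<tau> t"
proof -
  define M where "M = nat \<lceil>t\<rceil>"
  have M: "t \<le> real M"
    unfolding M_def by linarith
  define S R where "S = (\<Sum>n\<le>M. of_real (p n - 1 / J) * alt_term X Y t (int n))"
    and "R = of_real (1 / J) * infsum (alt_term X Y t) {..<0}"
  have eq: "renewal_sol X Y t - of_real (1 / J) * infsum (alt_term X Y t) UNIV = S - R"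
    unfolding renewal_sol_eq[OF M] infsum_alt_term_split[OF M] S_def R_def
    by (simp add: left_diff_distrib distrib_left sum_subtractf sum_distrib_left)
  have S: "cmod S \<le> (\<Sum>n\<le>M. \<bar>p n - 1 / J\<bar> * (P * exp (- \<tau> * \<bar>t - real n\<bar>)))"
    unfolding S_def
  proof (rule sum_norm_le)
    fix n
    show "cmod (of_real (p n - 1 / J) * alt_term X Y t (int n))
        \<le> \<bar>p n - 1 / J\<bar> * (P * exp (- \<tau> * \<bar>t - real n\<bar>))"
      using mult_left_mono[OF alt_term_bound[of t "int n"] abs_ge_zero[of "p n - 1 / J"]]
      by (simp only: norm_mult norm_of_real of_int_of_nat_eq)
  qed
  have "0 \<le> 1 / J"
    using J_pos by simp
  then have R: "cmod R \<le> 1 / J * (P * exp (- \<tau> * t) * infsum (\<lambda>n. exp (- \<tau> * \<bar>real_of_int n\<bar>)) {..<0})"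
    using mult_left_mono[OF infsum_alt_term_negative_bound[of t], of "1 / J"] assms
    by (simp only: R_def norm_mult norm_of_real abs_of_nonneg less_imp_le)
  have "P * error_rate \<tau> t
      = (\<Sum>n\<le>M. \<bar>p n - 1 / J\<bar> * (P * exp (- \<tau> * \<bar>t - real n\<bar>)))
        + 1 / J * (P * exp (- \<tau> * t) * infsum (\<lambda>n. exp (- \<tau> * \<bar>real_of_int n\<bar>)) {..<0})"
    unfolding error_rate_def M_def[symmetric] distrib_left sum_distrib_left
    by (simp only: mult_ac)
  then show ?thesis
    unfolding eq using norm_triangle_ineq4[of S R] S R by linarith
qed

text \<open>By \<open>alt_term_shift\<close> every delayed summand becomes a combination of the same
  terms \<open>alt_term X Y t m\<close>. The recurrence for \<open>p\<close> then reassembles the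
  coefficients.\<close>

lemma renewal_sol_rec:
  "renewal_sol X Y t = X t + (\<Sum>k=1..N. of_real (w k) *
     (if even k then renewal_sol X Y else renewal_sol Y X) (t - real k))"
proof -
  interpret swapped: renewal_system w N \<tau> P Y X
    by (intro renewal_system.intro swap aperiodic_weights_axioms)
  define M where "M = nat \<lceil>t\<rceil>"
  have M: "t \<le> real M"
    unfolding M_def by linarith
  define c where "c k m = (if k \<le> m then p (m - k) else 0)" for k m
  have shifted: "(if even k then renewal_sol X Y else renewal_sol Y X) (t - real k)
      = (\<Sum>m\<le>M. of_real (c k m) * alt_term X Y t (int m))" for k
  proof -
    have tk: "t - real k \<le> real M" using M by simp
    have "(if even k then renewal_sol X Y else renewal_sol Y X) (t - real k)
        = (\<Sum>n\<le>M. of_real (p n) * (if even k then alt_term X Y else alt_term Y X) (t - real k) (int n))"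
      using renewal_sol_eq[OF tk] swapped.renewal_sol_eq[OF tk] by simp
    also have "\<dots> = (\<Sum>n\<le>M. of_real (p n) * alt_term X Y t (int (n + k)))"
      using alt_term_shift[of X Y t _ k] by simp
    also have "\<dots> = (\<Sum>m\<in>{k..M + k}. of_real (p (m - k)) * alt_term X Y t (int m))"
      by (rule sum.reindex_bij_witness[of _ "\<lambda>m. m - k" "\<lambda>n. n + k"]) auto
    \<comment> \<open>Indices above \<open>M\<close> drop out because the inputs vanish there, those
      below \<open>k\<close> because \<open>c k m = 0\<close>.\<close>
    also have "\<dots> = (\<Sum>m\<le>M. of_real (c k m) * alt_term X Y t (int m))"
    proof (rule sum.mono_neutral_cong)
      fix m assume "m \<in> {k..M + k} - {..M}"
      then show "of_real (p (m - k)) * alt_term X Y t (int m) = 0"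
        using M by (simp add: alt_term_eq_0)
    qed (auto simp: c_def)
    finally show ?thesis .
  qed
  \<comment> \<open>At \<open>m = 0\<close> the sum is 0 although \<open>p 0 = 1\<close>; the
    missing term is exactly \<open>X t\<close>.\<close>
  have weights: "(\<Sum>k=1..N. w k * c k m) = (if m = 0 then 0 else p m)" for m
    using p_rec_N[of m] by (auto simp: c_def intro!: sum.neutral)
  have "(\<Sum>k=1..N. of_real (w k) * (if even k then renewal_sol X Y else renewal_sol Y X) (t - real k))
      = (\<Sum>k=1..N. \<Sum>m\<le>M. of_real (w k * c k m) * alt_term X Y t (int m))"
    unfolding shifted by (simp add: sum_distrib_left mult.assoc)
  also have "\<dots> = (\<Sum>m\<le>M. \<Sum>k=1..N. of_real (w k * c k m) * alt_term X Y t (int m))"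
    by (rule sum.swap)
  also have "\<dots> = (\<Sum>m\<le>M. of_real (\<Sum>k=1..N. w k * c k m) * alt_term X Y t (int m))"
    by (simp only: of_real_sum sum_distrib_right)
  also have "X t + \<dots> = (\<Sum>m\<le>M. of_real (p m) * alt_term X Y t (int m))"
    unfolding weights
    by (simp add: sum.atMost_shift alt_term_def p_0)
  also have "\<dots> = renewal_sol X Y t"
    by (rule renewal_sol_eq[OF M, symmetric])
  finally show ?thesis by simp
qed

end

text \<open>By parity each delay carries only one of \<open>u\<close> and \<open>v\<close>, so the
  recurrence with weights \<open>w\<close> is the coupled system.\<close>

lemma delay_solution_renewal_sol:
  assumes "renewal_system w N \<tau> P X Y"
    and uv: "\<And>k. k \<in> {1..N} \<Longrightarrow> u k = (if even k then w k else 0)"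
            "\<And>k. k \<in> {1..N} \<Longrightarrow> v k = (if even k then 0 else w k)"
  shows "delay_solution N u v X Y (aperiodic_weights.renewal_sol w X Y)
           (aperiodic_weights.renewal_sol w Y X)"
proof -
  interpret renewal_system w N \<tau> P X Y by fact
  interpret swapped: renewal_system w N \<tau> P Y X
    by (intro renewal_system.intro swap aperiodic_weights_axioms)
  have eq_X: "renewal_sol X Y t = X t + (\<Sum>k=1..N. of_real (u k) * renewal_sol X Y (t - real k)
          + of_real (v k) * renewal_sol Y X (t - real k))" for t
    by (subst renewal_sol_rec, rule arg_cong[of _ _ "(+) (X t)"], rule sum.cong) (auto simp: uv)
  have eq_Y: "renewal_sol Y X t = Y t + (\<Sum>k=1..N. of_real (u k) * renewal_sol Y X (t - real k)
          + of_real (v k) * renewal_sol X Y (t - real k))" for t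
    by (subst swapped.renewal_sol_rec, rule arg_cong[of _ _ "(+) (Y t)"], rule sum.cong) (auto simp: uv)
  show ?thesis
    unfolding delay_solution_def
    by (intro conjI allI impI continuous_renewal_sol swapped.continuous_renewal_sol eq_X eq_Y
          renewal_sol_eq_0 swapped.renewal_sol_eq_0 less_imp_le)
qed

section \<open>Asymptotics of the delay system\<close>

theorem mainTheorem3:
  fixes \<tau> :: real and N :: nat and u v :: "nat \<Rightarrow> real"
  assumes "\<tau> > 0"
    and "N \<ge> 1"
    and "\<And>k. k \<in> {1..N} \<Longrightarrow> u k \<ge> 0"
    and "\<And>k. k \<in> {1..N} \<Longrightarrow> v k \<ge> 0"
    and "(\<Sum>k=1..N. u k + v k) = 1"
    and "(\<Sum>k=1..N. v k) > 0"
    and "Gcd {k \<in> {1..N}. u k + v k > 0} = 1"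
    and "\<And>k. k \<in> {1..N} \<Longrightarrow> odd k \<Longrightarrow> u k = 0"
    and "\<And>k. k \<in> {1..N} \<Longrightarrow> even k \<Longrightarrow> v k = 0"
  shows "\<exists>C :: real \<Rightarrow> real. (C \<longlongrightarrow> 0) at_top \<and>
    (\<forall>(\<Pi>\<^sub>1::real) (\<Pi>\<^sub>2::real) (X\<^sub>1 :: real \<Rightarrow> complex) (X\<^sub>2 :: real \<Rightarrow> complex).
       \<Pi>\<^sub>1 > 0 \<longrightarrow> \<Pi>\<^sub>2 > 0 \<longrightarrow>
       decaying_input \<tau> \<Pi>\<^sub>1 X\<^sub>1 \<longrightarrow> decaying_input \<tau> \<Pi>\<^sub>2 X\<^sub>2 \<longrightarrow>
       (let s = periodic_limit N u v X\<^sub>1 X\<^sub>2 in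
         (\<forall>t. periodic_limit_term X\<^sub>1 X\<^sub>2 t summable_on UNIV) \<and>
         continuous_on UNIV s \<and> (\<forall>t. s (t + 2) = s t) \<and>
         (\<exists>!(Z\<^sub>1, Z\<^sub>2). delay_solution N u v X\<^sub>1 X\<^sub>2 Z\<^sub>1 Z\<^sub>2) \<and>
         (\<forall>Z\<^sub>1 Z\<^sub>2. delay_solution N u v X\<^sub>1 X\<^sub>2 Z\<^sub>1 Z\<^sub>2 \<longrightarrow>
            (\<forall>t>0. cmod (Z\<^sub>1 t - s t) \<le> (\<Pi>\<^sub>1 + \<Pi>\<^sub>2) * C t \<and>
                   cmod (Z\<^sub>2 t - s (t - 1)) \<le> (\<Pi>\<^sub>1 + \<Pi>\<^sub>2) * C t))))"
(is "\<exists>C. _ \<and> ?estimate C")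
proof -
  \<comment> \<open>Extension by 0, because \<open>u\<close> and \<open>v\<close> are arbitrary
    outside \<open>{1..N}\<close>.\<close>
  define w where "w k = (if k \<in> {1..N} then u k + v k else 0)" for k
  have support: "{k. w k > 0} = {k \<in> {1..N}. u k + v k > 0}"
    by (auto simp: w_def)
  interpret aperiodic_weights w N
  proof
    show "(\<Sum>k=1..N. w k) = 1"
      using assms(5) by (simp add: w_def)
    show "Gcd {k. w k > 0} = 1"
      unfolding support by fact
  qed (use assms(3,4) in \<open>auto simp: w_def\<close>)
  have J_eq: "mean_step N u v = J"
    by (simp add: mean_step_def J_def w_def)
  \<comment> \<open>The parity conditions recover \<open>u\<close> and \<open>v\<close> from their
    sum.\<close>
  have u_w: "u k = (if even k then w k else 0)" and v_w: "v k = (if even k then 0 else w k)"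
    if "k \<in> {1..N}" for k
    using assms(8,9)[OF that] that by (auto simp: w_def)
  \<comment> \<open>The rate is fixed before the inputs are introduced, which gives the required
    uniformity.\<close>
  have "?estimate (error_rate \<tau>)"
  proof (intro allI impI, goal_cases)
    case (1 \<Pi>\<^sub>1 \<Pi>\<^sub>2 X Y)
    define P where "P = \<Pi>\<^sub>1 + \<Pi>\<^sub>2"
    have "exponentially_bounded_pair \<tau> P X Y"
    proof
      show "continuous_on UNIV X" "continuous_on UNIV Y"
        using 1 by (auto simp: decaying_input_def)
      show "cmod (X t) \<le> P * exp (- \<tau> * \<bar>t\<bar>)" "cmod (Y t) \<le> P * exp (- \<tau> * \<bar>t\<bar>)" for t
        using 1 decaying_input_bound[of \<tau> \<Pi>\<^sub>1 X P t] decaying_input_bound[of \<tau> \<Pi>\<^sub>2 Y P t]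
        by (auto simp: P_def)
      show "X t = 0" "Y t = 0" if "t \<le> 0" for t
        using 1 that decaying_input_eq_0 by blast+
    qed (use assms(1) 1 in \<open>auto simp: P_def\<close>)
    then interpret renewal_system w N \<tau> P X Y
      by (intro renewal_system.intro aperiodic_weights_axioms)
    interpret swapped: renewal_system w N \<tau> P Y X
      by (intro renewal_system.intro swap aperiodic_weights_axioms)
    define s where "s = periodic_limit N u v X Y"
    have s: "s = (\<lambda>t. of_real (1 / J) * infsum (alt_term X Y t) UNIV)"
      unfolding s_def periodic_limit_eq J_eq by (rule refl)
    have s_shift: "s (t - 1) = of_real (1 / J) * infsum (alt_term Y X t) UNIV" for t
      by (simp only: s infsum_alt_term_shift[of Y X t])
    have sol: "delay_solution N u v X Y (renewal_sol X Y) (renewal_sol Y X)"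
      by (rule delay_solution_renewal_sol[OF renewal_system_axioms u_w v_w])
    have "periodic_limit_term X Y t summable_on UNIV" for t
      using has_sum_periodic_limit_term by (auto simp: summable_on_def)
    moreover have "continuous_on UNIV s"
      unfolding s by (intro continuous_on_mult continuous_on_const continuous_infsum_alt_term)
    \<comment> \<open>Two unit shifts, each exchanging the inputs.\<close>
    moreover have "s (t + 2) = s t" for t
      using s_shift[of "t + 1"] infsum_alt_term_shift[of X Y "t + 2"] by (auto simp: s add.commute)
    moreover have "\<exists>!(Z\<^sub>1, Z\<^sub>2). delay_solution N u v X Y Z\<^sub>1 Z\<^sub>2"
      using sol delay_solution_unique by (intro ex1I[of _ "(renewal_sol X Y, renewal_sol Y X)"]) auto
    \<comment> \<open>By uniqueness any solution is the renewal pair, to which the bound applies in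
      both orders of the inputs.\<close>
    moreover have "cmod (Z\<^sub>1 t - s t) \<le> P * error_rate \<tau> t \<and> cmod (Z\<^sub>2 t - s (t - 1)) \<le> P * error_rate \<tau> t"
      if "delay_solution N u v X Y Z\<^sub>1 Z\<^sub>2" "t > 0" for Z\<^sub>1 Z\<^sub>2 t
      using delay_solution_unique[OF that(1) sol] renewal_sol_bound[OF that(2)]
        swapped.renewal_sol_bound[OF that(2)]
      unfolding s_shift by (simp only: s)
    ultimately show ?case
      unfolding Let_def s_def P_def by blast
  qed
  then show ?thesis
    using error_rate_tendsto_0[OF assms(1)] by blast
qed

end
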